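(* Let $n\ge 1$. If $D\subset\mathbb{RP}^n$ is an open convex set, then its elliptic tube $D^e\subset\mathbb{CP}^n$ is linearly convex.
   Context: A set $E\subset\mathbb{RP}^n$ is convex if it contains no projective line and its intersection with every projective line is connected. A set $E\subset\mathbb{CP}^n$ is linearly convex if every point of the complement of $E$ lies on a complex projective hyperplane disjoint from $E$. Elliptic tubes: regard $\mathbb{RP}^n\subset\mathbb{CP}^n$ and write $\pi$ for the projections $\mathbb{R}^{n+1}\setminus\{0\}\to\mathbb{RP}^n$, $\mathbb{C}^{n+1}\setminus\{0\}\to\mathbb{CP}^n$. A closed segment $I\subset\mathbb{RP}^n$ with endpoints $a_0,a_1$ can be written as $I=\pi(\{c_0v_0+c_1v_1\neq 0 : c_0,c_1\in\mathbb{R},\ c_0c_1\ge 0\})$ for suitable $v_0,v_1\in\mathbb{R}^{n+1}$ with $\pi(v_i)=a_i$; put $I^e=\pi(\{c_0v_0+c_1v_1\neq 0 : c_0,c_1\in\mathbb{C},\ \mathrm{Re}(c_0\overline{c_1})\ge 0\})$. For $D\subset\mathbb{RP}^n$, the elliptic tube is $D^e=\bigcup\{I^e : I\subset D \text{ a closed segment}\}\subset\mathbb{CP}^n$. *)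

theory Defs
  imports "HOL-Analysis.Analysis"
begin

text \<open>The projective space of \<open>'a ^ 'n\<close>, of dimension \<open>CARD('n) - 1\<close>. The canonical projection
  \<open>abs_proj\<close> is meaningful on nonzero vectors only.\<close>

quotient_type (overloaded) ('a, 'n) proj = "'a::field ^ 'n::finite" /
  partial: "\<lambda>x y. x \<noteq> 0 \<and> y \<noteq> 0 \<and> (\<exists>c. c \<noteq> 0 \<and> y = c *s x)"
proof (rule part_equivpI)
  show "\<exists>x :: 'a ^ 'n. x \<noteq> 0 \<and> x \<noteq> 0 \<and> (\<exists>c. c \<noteq> 0 \<and> x = c *s x)"
  proof (intro exI conjI)
    show "(1 :: 'a ^ 'n) \<noteq> 0" "(1 :: 'a ^ 'n) \<noteq> 0"
      by (simp_all add: vec_eq_iff)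
    show "(1 :: 'a) \<noteq> 0" "(1 :: 'a ^ 'n) = 1 *s 1"
      by simp_all
  qed
  show "symp (\<lambda>x y :: 'a ^ 'n. x \<noteq> 0 \<and> y \<noteq> 0 \<and> (\<exists>c. c \<noteq> 0 \<and> y = c *s x))"
  proof (rule sympI, elim conjE exE, intro conjI)
    fix x y :: "'a ^ 'n" and c :: 'a
    assume "c \<noteq> 0" "y = c *s x"
    then have "inverse c \<noteq> 0 \<and> x = inverse c *s y"
      by (simp add: vector_smult_assoc)
    then show "\<exists>d. d \<noteq> 0 \<and> x = d *s y"
      by (rule exI)
  qed
  show "transp (\<lambda>x y :: 'a ^ 'n. x \<noteq> 0 \<and> y \<noteq> 0 \<and> (\<exists>c. c \<noteq> 0 \<and> y = c *s x))"
  proof (rule transpI, elim conjE exE, intro conjI)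
    fix x y z :: "'a ^ 'n" and c d :: 'a
    assume "c \<noteq> 0" "y = c *s x" "d \<noteq> 0" "z = d *s y"
    then have "d * c \<noteq> 0 \<and> z = (d * c) *s x"
      by (simp add: vector_smult_assoc)
    then show "\<exists>e. e \<noteq> 0 \<and> z = e *s x"
      by (rule exI)
  qed
qed

definition proj_image :: "('a::field ^ 'n::finite) set \<Rightarrow> ('a, 'n) proj set" where
  "proj_image A = abs_proj ` (A - {0})"

text \<open>The quotient topology. As \<open>{v. v \<noteq> 0}\<close> is open, relative openness of the preimage is openness.\<close>

instantiation proj :: (real_normed_field, finite) topological_space
begin

definition open_proj :: "('a, 'b) proj set \<Rightarrow> bool" where
  "open_proj U \<longleftrightarrow> open {v. v \<noteq> 0 \<and> abs_proj v \<in> U}"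

instance
proof
  have "{v :: 'a ^ 'b. v \<noteq> 0} = - {0}"
    by auto
  then show "open (UNIV :: ('a, 'b) proj set)"
    by (simp add: open_proj_def open_Compl)
next
  fix S T :: "('a, 'b) proj set"
  assume "open S" "open T"
  moreover have "{v. v \<noteq> 0 \<and> abs_proj v \<in> S \<inter> T} =
      {v. v \<noteq> 0 \<and> abs_proj v \<in> S} \<inter> {v. v \<noteq> 0 \<and> abs_proj v \<in> T}"
    by auto
  ultimately show "open (S \<inter> T)"
    by (simp add: open_proj_def open_Int del: mem_Collect_eq)
next
  fix K :: "('a, 'b) proj set set"
  assume "\<forall>S\<in>K. open S"
  moreover have "{v. v \<noteq> 0 \<and> abs_proj v \<in> \<Union>K} = (\<Union>S\<in>K. {v. v \<noteq> 0 \<and> abs_proj v \<in> S})"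
    by auto
  ultimately show "open (\<Union>K)"
    unfolding open_proj_def by (simp add: open_UN)
qed

end

definition proj_line :: "('a::field, 'n::finite) proj set \<Rightarrow> bool" where
  "proj_line L \<longleftrightarrow> (\<exists>S. vec.subspace S \<and> vec.dim S = 2 \<and> L = proj_image S)"

definition proj_hyperplane :: "('a::field, 'n::finite) proj set \<Rightarrow> bool" where
  "proj_hyperplane H \<longleftrightarrow> (\<exists>S. vec.subspace S \<and> vec.dim S + 1 = CARD('n) \<and> H = proj_image S)"

definition proj_convex :: "(real, 'n::finite) proj set \<Rightarrow> bool" where
  "proj_convex E \<longleftrightarrow>
     (\<forall>L. proj_line L \<longrightarrow> \<not> L \<subseteq> E) \<and> (\<forall>L. proj_line L \<longrightarrow> connected (E \<inter> L))"

definition linearly_convex :: "(complex, 'n::finite) proj set \<Rightarrow> bool" where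
  "linearly_convex E \<longleftrightarrow> (\<forall>p. p \<notin> E \<longrightarrow> (\<exists>H. proj_hyperplane H \<and> p \<in> H \<and> H \<inter> E = {}))"

definition complexify :: "real ^ 'n \<Rightarrow> complex ^ 'n" where
  "complexify v = (\<chi> i. complex_of_real (v $ i))"

text \<open>Representatives of the endpoints of a segment select one of the two segments joining them;
  when the endpoints coincide, the segment is that point.\<close>

definition proj_segment :: "real ^ 'n \<Rightarrow> real ^ 'n \<Rightarrow> (real, 'n::finite) proj set" where
  "proj_segment v0 v1 = proj_image {c0 *s v0 + c1 *s v1 | c0 c1. c0 * c1 \<ge> 0}"

definition elliptic_segment :: "real ^ 'n \<Rightarrow> real ^ 'n \<Rightarrow> (complex, 'n::finite) proj set" where
  "elliptic_segment v0 v1 =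
     proj_image {c0 *s complexify v0 + c1 *s complexify v1 | c0 c1. Re (c0 * cnj c1) \<ge> 0}"

text \<open>The union runs over representatives \<open>v0, v1\<close> rather than over segments: those of one and the
  same segment differ by order, positive factors and a common sign (if the endpoints are distinct),
  none of which affects \<open>elliptic_segment v0 v1\<close>.\<close>

definition elliptic_tube :: "(real, 'n::finite) proj set \<Rightarrow> (complex, 'n) proj set" where
  "elliptic_tube D =
     \<Union> {elliptic_segment v0 v1 | v0 v1. v0 \<noteq> 0 \<and> v1 \<noteq> 0 \<and> proj_segment v0 v1 \<subseteq> D}"

end

theory Submission
  imports Defs
begin

text \<open>The set \<open>D\<close> lifts to an open convex cone \<open>C\<close>. A complex functional \<open>f\<close> has no zero on the
  elliptic segments of \<open>D\<close> as soon as it maps \<open>C\<close> into an open quadrant, so for \<open>z = x + \<i> y\<close>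
  outside the tube one needs such an \<open>f\<close> with \<open>f z = 0\<close>. On the real plane spanned by \<open>x\<close> and
  \<open>y\<close> the functional \<open>f\<close> is determined up to a complex factor, and \<open>z\<close> being outside the tube
  says exactly that the image of the plane section of \<open>C\<close> has only acute angles; a rotation
  brings it into the open quadrant. The real and imaginary parts of \<open>f\<close> are then extended
  separately by Hahn-Banach, keeping them positive on \<open>C\<close>. If the plane misses \<open>C\<close>, a real
  functional separating the two will do.\<close>

section \<open>Projective space\<close>

lemma abs_proj_eq_iff:
  assumes "x \<noteq> 0" "y \<noteq> 0"
  shows "abs_proj x = abs_proj y \<longleftrightarrow> (\<exists>c. c \<noteq> 0 \<and> y = c *s x)"
proof -
  have refl: "u \<noteq> 0 \<and> u \<noteq> 0 \<and> (\<exists>c. c \<noteq> 0 \<and> u = c *s u)" if "u \<noteq> 0" for u :: "'a ^ 'b"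
    using that by (auto intro!: exI[of _ 1])
  show ?thesis
    using Quotient3_rel[OF Quotient3_proj, of x y] refl[OF assms(1)] refl[OF assms(2)] assms
    by auto
qed

lemma abs_proj_surj:
  obtains x where "x \<noteq> 0" "p = abs_proj x"
proof -
  have "rep_proj p \<noteq> 0"
    using Quotient3_rep_reflp[OF Quotient3_proj, of p] by auto
  moreover have "p = abs_proj (rep_proj p)"
    using Quotient3_abs_rep[OF Quotient3_proj, of p] by simp
  ultimately show ?thesis by (rule that)
qed

text \<open>The punctured cone over \<open>D\<close>: topology and convexity of \<open>D\<close> are
  studied on it, with straight segments of vectors in place of projective segments.\<close>

definition proj_preimage :: "('a::field, 'n::finite) proj set \<Rightarrow> ('a ^ 'n) set" where
  "proj_preimage D = {v. v \<noteq> 0 \<and> abs_proj v \<in> D}"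

lemma open_proj_preimage: "open (proj_preimage D) \<longleftrightarrow> open D"
  by (simp add: proj_preimage_def open_proj_def)

lemma proj_preimage_smult:
  assumes "c \<noteq> 0"
  shows "c *s v \<in> proj_preimage D \<longleftrightarrow> v \<in> proj_preimage D"
proof (cases "v = 0")
  case False
  with assms have "c *s v \<noteq> 0" by simp
  with False assms have "abs_proj v = abs_proj (c *s v)"
    by (subst abs_proj_eq_iff) auto
  with False assms show ?thesis by (simp add: proj_preimage_def)
qed (simp add: proj_preimage_def)

lemma proj_preimage_scaleR:
  fixes D :: "(real, 'n::finite) proj set"
  shows "c \<noteq> 0 \<Longrightarrow> c *\<^sub>R v \<in> proj_preimage D \<longleftrightarrow> v \<in> proj_preimage D"
  using proj_preimage_smult[of c v D] by (simp add: scalar_mult_eq_scaleR)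

lemma proj_preimage_uminus:
  fixes D :: "(real, 'n::finite) proj set"
  shows "- v \<in> proj_preimage D \<longleftrightarrow> v \<in> proj_preimage D"
  using proj_preimage_scaleR[of "-1" v D] by simp

lemma proj_image_subset_iff: "proj_image A \<subseteq> D \<longleftrightarrow> A - {0} \<subseteq> proj_preimage D"
  by (auto simp: proj_image_def proj_preimage_def)

section \<open>The cone over a convex set\<close>

text \<open>A compact segment inside an open set keeps a uniform distance \<open>e\<close> from the
  complement, and shifting one endpoint shifts no point of the segment further than the
  endpoint.\<close>

lemma open_segment_endpoints:
  fixes U :: "'a::euclidean_space set"
  assumes "open U"
  shows "open {u. closed_segment u w \<subseteq> U}"
  unfolding open_dist
proof (intro ballI)
  fix u assume "u \<in> {u. closed_segment u w \<subseteq> U}"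
  then obtain e where "e > 0" and e: "(\<Union>x\<in>closed_segment u w. ball x e) \<subseteq> U"
    using compact_subset_open_imp_ball_epsilon_subset[OF compact_segment[of u w] assms] by blast
  show "\<exists>e>0. \<forall>y. dist y u < e \<longrightarrow> y \<in> {u. closed_segment u w \<subseteq> U}"
  proof (intro exI conjI allI impI CollectI subsetI)
    fix y z assume y: "dist y u < e" and "z \<in> closed_segment y w"
    then obtain t where t: "0 \<le> t" "t \<le> 1" and z: "z = (1 - t) *\<^sub>R y + t *\<^sub>R w"
      by (auto simp: in_segment)
    let ?x = "(1 - t) *\<^sub>R u + t *\<^sub>R w"
    have "dist ?x z = (1 - t) * dist y u"
      using t by (simp add: z dist_norm norm_minus_commute flip: scaleR_diff_right)
    also have "\<dots> \<le> dist y u"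
      using t by (simp add: mult_left_le_one_le)
    finally have "z \<in> ball ?x e" using y by simp
    moreover have "?x \<in> closed_segment u w" using t by (auto simp: in_segment)
    ultimately show "z \<in> U" using e by blast
  qed fact
qed

lemma obtain_dual_functional:
  fixes v w :: "'a::euclidean_space"
  assumes "\<And>a b. a *\<^sub>R v + b *\<^sub>R w = 0 \<Longrightarrow> a = 0 \<and> b = 0"
  obtains f where "linear f" "f v = (s::real)" "f w = t"
proof -
  have ne: "v \<noteq> w" using assms[of 1 "-1"] by auto
  have "w \<noteq> 0" using assms[of 0 1] by auto
  moreover have "v \<notin> span {w}"
  proof
    assume "v \<in> span {w}"
    then obtain k where "v = k *\<^sub>R w" by (auto simp: span_singleton)
    then show False using assms[of 1 "-k"] by simp
  qed
  ultimately have "independent {v, w}"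
    using ne by (simp add: independent_insert)
  then obtain f where "linear f" "\<forall>x\<in>{v, w}. f x = (if x = v then s else t)"
    using linear_independent_extend[of "{v, w}" "\<lambda>x. if x = v then s else t"] by blast
  with ne that show ?thesis by auto
qed

text \<open>A product of two functionals is homogeneous of degree 2, so its sign, unlike that of a
  single functional, is well defined on projective points.\<close>

lemma open_proj_sign:
  fixes \<phi> \<psi> :: "real ^ 'n::finite \<Rightarrow> real"
  assumes "linear \<phi>" "linear \<psi>"
  defines "A \<equiv> {p. \<exists>x. x \<noteq> 0 \<and> p = abs_proj x \<and> \<phi> x * \<psi> x > 0}"
  shows "open A" and "x \<noteq> 0 \<Longrightarrow> abs_proj x \<in> A \<longleftrightarrow> \<phi> x * \<psi> x > 0"
proof -
  show iff: "abs_proj x \<in> A \<longleftrightarrow> \<phi> x * \<psi> x > 0" if x: "x \<noteq> 0" for x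
  proof
    assume "abs_proj x \<in> A"
    then obtain y where y: "y \<noteq> 0" "abs_proj x = abs_proj y" "\<phi> y * \<psi> y > 0"
      by (auto simp: A_def)
    then obtain c where c: "y = c *\<^sub>R x"
      using x abs_proj_eq_iff[of x y] by (auto simp: scalar_mult_eq_scaleR)
    have "c\<^sup>2 * (\<phi> x * \<psi> x) > 0"
      using y(3) assms(1,2) by (simp add: c linear_cmul power2_eq_square mult_ac)
    then show "\<phi> x * \<psi> x > 0" by (simp add: zero_less_mult_iff)
  qed (use x in \<open>auto simp: A_def\<close>)
  \<comment> \<open>At the origin the product is 0, so the inequality already excludes it.\<close>
  have "{v. v \<noteq> 0 \<and> abs_proj v \<in> A} = {v. \<phi> v * \<psi> v > 0}"
    using iff linear_0[OF assms(1)] by (intro Collect_cong) (metis mult_zero_left less_irrefl)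
  moreover have "open {v. \<phi> v * \<psi> v > 0}"
    using assms(1,2) by (intro open_Collect_less continuous_intros linear_continuous_on linear_linear[THEN iffD2])
      (auto simp: linear_conv_bounded_linear)
  ultimately show "open A"
    by (simp add: open_proj_def)
qed

lemma proj_line_span:
  fixes v w :: "real ^ 'n::finite"
  assumes "\<And>a b. a *\<^sub>R v + b *\<^sub>R w = 0 \<Longrightarrow> a = 0 \<and> b = 0"
  shows "proj_line (proj_image {a *\<^sub>R v + b *\<^sub>R w | a b. True})"
proof -
  have ne: "v \<noteq> w" using assms[of 1 "-1"] by auto
  have "w \<noteq> 0" using assms[of 0 1] by auto
  moreover have vw: "v \<notin> vec.span {w}"
  proof
    assume "v \<in> vec.span {w}"
    then obtain k where "v = k *s w" by (auto simp: vec.span_singleton)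
    then show False using assms[of 1 "-k"] by (simp add: scalar_mult_eq_scaleR)
  qed
  ultimately have "vec.independent {v, w}"
    using ne by (simp add: vec.independent_insert)
  then have "vec.dim (vec.span {v, w}) = 2"
    using ne by (simp add: vec.dim_eq_card_independent)
  moreover have "vec.span {v, w} = {a *\<^sub>R v + b *\<^sub>R w | a b. True}"
  proof -
    have "x \<in> vec.span {v, w} \<longleftrightarrow> (\<exists>a b. x - a *s v = b *s w)" for x
      unfolding vec.span_insert[of v] vec.span_singleton by auto
    then have "x \<in> vec.span {v, w} \<longleftrightarrow> (\<exists>a b. x = a *\<^sub>R v + b *\<^sub>R w)" for x
      by (simp only: scalar_mult_eq_scaleR diff_eq_eq add.commute)
    then show ?thesis by auto
  qed
  ultimately show ?thesis
    unfolding proj_line_def by (metis vec.subspace_span)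
qed

text \<open>For independent \<open>v\<close> and \<open>w\<close> the two segments project to the
  two arcs joining two points of a projective line \<open>L\<close>. If both arcs lie in
  \<open>D\<close>, so does \<open>L\<close>. If each misses a point of \<open>D\<close>, the two
  missing points disconnect \<open>D \<inter> L\<close>.\<close>

lemma segment_dichotomy:
  fixes D :: "(real, 'n::finite) proj set"
  assumes "proj_convex D" "v \<in> proj_preimage D" "w \<in> proj_preimage D"
  shows "closed_segment v w \<subseteq> proj_preimage D \<longleftrightarrow> \<not> closed_segment v (- w) \<subseteq> proj_preimage D"
proof (cases "\<exists>a b. a *\<^sub>R v + b *\<^sub>R w = 0 \<and> \<not> (a = 0 \<and> b = 0)")
  \<comment> \<open>Here \<open>w\<close> is a nonzero real multiple of \<open>v\<close>, and
    exactly one of the segments to \<open>w\<close> and to \<open>- w\<close> passes through the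
    origin.\<close>
  case True
  have nz: "v \<noteq> 0" "w \<noteq> 0" "0 \<notin> proj_preimage D"
    using assms by (auto simp: proj_preimage_def)
  from True obtain a b where ab: "a *\<^sub>R v + b *\<^sub>R w = 0" "\<not> (a = 0 \<and> b = 0)" by blast
  with nz have "b \<noteq> 0" by auto
  define k where "k = - a / b"
  have "b *\<^sub>R w = - (a *\<^sub>R v)"
    using ab(1) by (simp add: add_eq_0_iff)
  then have "inverse b *\<^sub>R b *\<^sub>R w = inverse b *\<^sub>R (- (a *\<^sub>R v))" by simp
  then have w: "w = k *\<^sub>R v"
    using \<open>b \<noteq> 0\<close> by (simp add: k_def field_simps)
  with nz have "k \<noteq> 0" by auto
  have pos: "closed_segment v (l *\<^sub>R v) \<subseteq> proj_preimage D" if "l > 0" for l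
  proof
    fix u assume "u \<in> closed_segment v (l *\<^sub>R v)"
    then obtain t where t: "0 \<le> t" "t \<le> 1" "u = (1 - t) *\<^sub>R v + t *\<^sub>R l *\<^sub>R v"
      by (auto simp: in_segment)
    then have "u = (1 - t + t * l) *\<^sub>R v" by (simp add: algebra_simps)
    moreover have "1 - t + t * l > 0"
      using t that by (cases "t = 1") (auto intro: add_pos_nonneg)
    ultimately show "u \<in> proj_preimage D"
      using assms(2) proj_preimage_scaleR[of "1 - t + t * l" v D] by simp
  qed
  have neg: "\<not> closed_segment v (l *\<^sub>R v) \<subseteq> proj_preimage D" if "l < 0" for l
  proof -
    \<comment> \<open>\<open>1 / (1 - l)\<close> is the parameter at which the segment crosses the
      origin.\<close>
    have "(1 - 1 / (1 - l)) *\<^sub>R v + (1 / (1 - l)) *\<^sub>R l *\<^sub>R v = 0"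
      using that by (simp add: field_simps flip: scaleR_left.add)
    then have "0 \<in> closed_segment v (l *\<^sub>R v)"
      using that by (force simp: in_segment intro!: exI[of _ "1 / (1 - l)"])
    with nz(3) show ?thesis by blast
  qed
  show ?thesis
    using pos[of k] neg[of k] pos[of "-k"] neg[of "-k"] \<open>k \<noteq> 0\<close> w
    by (cases "k > 0") auto
next
  case False
  then have indep: "a = 0 \<and> b = 0" if "a *\<^sub>R v + b *\<^sub>R w = 0" for a b
    using that by blast
  define L where "L = proj_image {a *\<^sub>R v + b *\<^sub>R w | a b. True}"
  have L: "proj_line L" unfolding L_def using indep by (rule proj_line_span)
  \<comment> \<open>Dividing by \<open>a + b\<close>, which is nonzero because the coefficients do
    not have opposite signs, gives a point of the segment.\<close>
  have pos: "a *\<^sub>R v + b *\<^sub>R u \<in> proj_preimage D"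
    if seg: "closed_segment v u \<subseteq> proj_preimage D" and ab: "a * b \<ge> 0" "a \<noteq> 0 \<or> b \<noteq> 0" for a b u
  proof -
    have s: "a + b \<noteq> 0"
      using ab by (auto simp: zero_le_mult_iff)
    have q: "0 \<le> b / (a + b)" "b / (a + b) \<le> 1"
      using ab s by (auto simp: field_simps zero_le_divide_iff divide_le_eq zero_le_mult_iff)
    have "1 - b / (a + b) = a / (a + b)" using s by (simp add: field_simps)
    then have "(a / (a + b)) *\<^sub>R v + (b / (a + b)) *\<^sub>R u \<in> closed_segment v u"
      using q by (auto simp: in_segment intro!: exI[of _ "b / (a + b)"])
    with seg have "(a + b) *\<^sub>R ((a / (a + b)) *\<^sub>R v + (b / (a + b)) *\<^sub>R u) \<in> proj_preimage D"
      using s by (subst proj_preimage_scaleR) auto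
    then show ?thesis using s by (simp add: scaleR_add_right)
  qed
  show ?thesis
  proof (rule iffI)
    assume 1: "closed_segment v w \<subseteq> proj_preimage D"
    show "\<not> closed_segment v (- w) \<subseteq> proj_preimage D"
    proof
      assume 2: "closed_segment v (- w) \<subseteq> proj_preimage D"
      have "a *\<^sub>R v + b *\<^sub>R w \<in> proj_preimage D" if "a *\<^sub>R v + b *\<^sub>R w \<noteq> 0" for a b
      proof (cases "a * b \<ge> 0")
        case True
        then show ?thesis using that by (intro pos 1) auto
      next
        case False
        then have "a *\<^sub>R v + (- b) *\<^sub>R (- w) \<in> proj_preimage D"
          using that by (intro pos 2) auto
        then show ?thesis by simp
      qed
      then have "L \<subseteq> D" unfolding L_def proj_image_subset_iff by blast
      with L assms(1) show False by (auto simp: proj_convex_def)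
    qed
  next
    assume 2: "\<not> closed_segment v (- w) \<subseteq> proj_preimage D"
    show "closed_segment v w \<subseteq> proj_preimage D"
    proof (rule ccontr)
      assume 1: "\<not> closed_segment v w \<subseteq> proj_preimage D"
      from 1 obtain x where "x \<in> closed_segment v w" "x \<notin> proj_preimage D" by blast
      then obtain s where s: "0 \<le> s" "s \<le> 1" "(1 - s) *\<^sub>R v + s *\<^sub>R w \<notin> proj_preimage D"
        by (auto simp: in_segment)
      from 2 obtain y where "y \<in> closed_segment v (- w)" "y \<notin> proj_preimage D" by blast
      then obtain t where t: "0 \<le> t" "t \<le> 1" "(1 - t) *\<^sub>R v - t *\<^sub>R w \<notin> proj_preimage D"
        by (auto simp: in_segment)
      \<comment> \<open>The endpoints lie over \<open>D\<close>, so the missing points are interior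
        to the segments.\<close>
      have s01: "0 < s" "s < 1" "0 < t" "t < 1"
        using s t assms(2,3) proj_preimage_uminus[of w D]
        by (auto simp: less_le)
      \<comment> \<open>The values are chosen so that \<open>\<phi>\<close> vanishes at the missing
        point \<open>(1 - s) v + s w\<close> and \<open>\<psi>\<close> at
        \<open>(1 - t) v - t w\<close>. The product is then positive at \<open>v\<close> and
        negative at \<open>w\<close>, and its sign separates the two points.\<close>
      obtain \<phi> where \<phi>: "linear \<phi>" "\<phi> v = s" "\<phi> w = - (1 - s)"
        using obtain_dual_functional[OF indep] by metis
      obtain \<psi> where \<psi>: "linear \<psi>" "\<psi> v = t" "\<psi> w = 1 - t"
        using obtain_dual_functional[OF indep] by metis
      have m\<phi>: "linear (\<lambda>x. - \<phi> x)" using \<phi>(1) by (rule linear_compose_neg)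
      define A where "A = {p. \<exists>x. x \<noteq> 0 \<and> p = abs_proj x \<and> \<phi> x * \<psi> x > 0}"
      define B where "B = {p. \<exists>x. x \<noteq> 0 \<and> p = abs_proj x \<and> - \<phi> x * \<psi> x > 0}"
      note A = open_proj_sign[OF \<phi>(1) \<psi>(1), folded A_def]
      note B = open_proj_sign[OF m\<phi> \<psi>(1), folded B_def]
      have nz: "v \<noteq> 0" "w \<noteq> 0" using assms by (auto simp: proj_preimage_def)
      have vL: "abs_proj v \<in> D \<inter> L" "abs_proj w \<in> D \<inter> L"
      proof -
        have "v = 1 *\<^sub>R v + 0 *\<^sub>R w" "w = 0 *\<^sub>R v + 1 *\<^sub>R w" by auto
        then have "v \<in> {a *\<^sub>R v + b *\<^sub>R w | a b. True}" "w \<in> {a *\<^sub>R v + b *\<^sub>R w | a b. True}"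
          by blast+
        then show "abs_proj v \<in> D \<inter> L" "abs_proj w \<in> D \<inter> L"
          using nz assms(2,3) by (auto simp: L_def proj_image_def proj_preimage_def)
      qed
      have "abs_proj v \<in> A" using A(2)[OF nz(1)] \<phi> \<psi> s01 by simp
      moreover have "abs_proj w \<in> B" using B(2)[OF nz(2)] \<phi> \<psi> s01 by simp
      moreover have "A \<inter> B \<inter> (D \<inter> L) = {}"
      proof -
        have "p \<notin> A \<inter> B" for p
        proof -
          obtain x where x: "x \<noteq> 0" "p = abs_proj x" by (rule abs_proj_surj)
          then show ?thesis using A(2)[OF x(1)] B(2)[OF x(1)] by auto
        qed
        then show ?thesis by blast
      qed
      moreover have "D \<inter> L \<subseteq> A \<union> B"
      proof
        fix p assume p: "p \<in> D \<inter> L"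
        then obtain a b where x0: "a *\<^sub>R v + b *\<^sub>R w \<noteq> 0" and px: "p = abs_proj (a *\<^sub>R v + b *\<^sub>R w)"
          by (auto simp: L_def proj_image_def)
        let ?x = "a *\<^sub>R v + b *\<^sub>R w"
        have xD: "?x \<in> proj_preimage D" using p px x0 by (auto simp: proj_preimage_def)
        have \<phi>x: "\<phi> ?x = a * s - b * (1 - s)" and \<psi>x: "\<psi> ?x = a * t + b * (1 - t)"
          by (simp_all only: linear_add[OF \<phi>(1)] linear_add[OF \<psi>(1)] linear_cmul[OF \<phi>(1)]
              linear_cmul[OF \<psi>(1)] \<phi>(2,3) \<psi>(2,3)) (simp_all add: algebra_simps)
        \<comment> \<open>On the plane the kernel of \<open>\<phi>\<close> is the line through the
          missing point, so a zero over \<open>D\<close> is impossible; the same holds for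
          \<open>\<psi>\<close>.\<close>
        have "\<phi> ?x \<noteq> 0"
        proof
          assume "\<phi> ?x = 0"
          then have "b = (a + b) * s" "a = (a + b) * (1 - s)" using \<phi>x by (auto simp: algebra_simps)
          then have "(a + b) *\<^sub>R ((1 - s) *\<^sub>R v + s *\<^sub>R w) = ?x"
            by (simp only: scaleR_add_right scaleR_scaleR)
          then have "?x = (a + b) *\<^sub>R ((1 - s) *\<^sub>R v + s *\<^sub>R w)" ..
          moreover from this x0 have "a + b \<noteq> 0" by auto
          ultimately show False using xD s(3) by (metis proj_preimage_scaleR)
        qed
        moreover have "\<psi> ?x \<noteq> 0"
        proof
          assume "\<psi> ?x = 0"
          then have "- b = (a - b) * t" "a = (a - b) * (1 - t)" using \<psi>x by (auto simp: algebra_simps)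
          then have "(a - b) *\<^sub>R ((1 - t) *\<^sub>R v - t *\<^sub>R w) = a *\<^sub>R v - (- b) *\<^sub>R w"
            by (simp only: scaleR_diff_right scaleR_scaleR)
          then have "?x = (a - b) *\<^sub>R ((1 - t) *\<^sub>R v - t *\<^sub>R w)" by simp
          moreover from this x0 have "a - b \<noteq> 0" by auto
          ultimately show False using xD t(3) by (metis proj_preimage_scaleR)
        qed
        ultimately have "\<phi> ?x * \<psi> ?x > 0 \<or> - \<phi> ?x * \<psi> ?x > 0"
          by (metis mult_eq_0_iff mult_minus_left neg_0_less_iff_less not_less_iff_gr_or_eq)
        then show "p \<in> A \<union> B"
          using A(2)[OF x0] B(2)[OF x0] px by blast
      qed
      moreover have "connected (D \<inter> L)" using assms(1) L by (auto simp: proj_convex_def)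
      ultimately show False
        using A(1) B(1) vL unfolding connected_def by blast
    qed
  qed
qed

text \<open>As a point runs along the segment from \<open>w\<close> to \<open>v\<close>, exactly one
  of \<open>u\<close> and \<open>- u\<close> can be joined to it over \<open>D\<close>. Both
  alternatives are open conditions, so by connectedness the choice made at \<open>w\<close> persists
  up to \<open>v\<close>.\<close>

lemma segment_relation_trans:
  fixes D :: "(real, 'n::finite) proj set"
  assumes "open D" "proj_convex D"
    and vw: "closed_segment v w \<subseteq> proj_preimage D" and wu: "closed_segment w u \<subseteq> proj_preimage D"
  shows "closed_segment v u \<subseteq> proj_preimage D"
proof -
  let ?O = "proj_preimage D"
  let ?A = "{x. closed_segment x u \<subseteq> ?O}" and ?B = "{x. closed_segment x (- u) \<subseteq> ?O}"
  have op: "open ?O" using assms(1) by (simp add: open_proj_preimage)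
  have u: "u \<in> ?O" using wu by auto
  have dich: "x \<in> ?A \<longleftrightarrow> x \<notin> ?B" if "x \<in> ?O" for x
    using segment_dichotomy[OF assms(2) that u] by simp
  have "?A \<inter> closed_segment v w = {} \<or> ?B \<inter> closed_segment v w = {}"
  proof (rule connectedD[OF connected_segment])
    show "open ?A" "open ?B" by (rule open_segment_endpoints[OF op])+
    have "\<forall>x\<in>closed_segment v w. x \<in> ?A \<longleftrightarrow> x \<notin> ?B" using dich vw by blast
    then show "?A \<inter> ?B \<inter> closed_segment v w = {}" "closed_segment v w \<subseteq> ?A \<union> ?B"
      by blast+
  qed
  moreover have "w \<in> ?A \<inter> closed_segment v w" using wu by simp
  ultimately show ?thesis using dich[of v] vw by blast
qed

text \<open>The cone is one of the two opposite classes of the equivalence relation saying that the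
  straight segment from \<open>v\<close> to \<open>w\<close> stays over \<open>D\<close>.\<close>

lemma obtain_convex_cone:
  fixes D :: "(real, 'n::finite) proj set"
  assumes "open D" "proj_convex D" "D \<noteq> {}"
  obtains C where "open C" "convex C" "C \<noteq> {}" "0 \<notin> C" "\<And>k v. k > 0 \<Longrightarrow> v \<in> C \<Longrightarrow> k *\<^sub>R v \<in> C"
    "C \<subseteq> proj_preimage D"
    "\<And>v w. closed_segment v w \<subseteq> proj_preimage D \<Longrightarrow> (v \<in> C \<and> w \<in> C) \<or> (- v \<in> C \<and> - w \<in> C)"
proof -
  let ?O = "proj_preimage D"
  have op: "open ?O" using assms(1) by (simp add: open_proj_preimage)
  obtain p where p: "p \<in> D" using assms(3) by blast
  obtain o' where "o' \<noteq> 0" "p = abs_proj o'" by (rule abs_proj_surj)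
  with p have o': "o' \<in> ?O" by (simp add: proj_preimage_def)
  define C where "C = {v. closed_segment o' v \<subseteq> ?O}"
  have CO: "C \<subseteq> ?O" unfolding C_def by auto
  have closed: "w \<in> C" if "v \<in> C" "closed_segment v w \<subseteq> ?O" for v w
    using segment_relation_trans[OF assms(1,2), of o' v w] that by (simp add: C_def)
  have rel: "closed_segment v w \<subseteq> ?O" if "v \<in> C" "w \<in> C" for v w
    using segment_relation_trans[OF assms(1,2), of v o' w] that
    by (simp add: C_def closed_segment_commute)
  show ?thesis
  proof
    show "open C"
      using open_segment_endpoints[OF op, of o'] by (simp add: C_def closed_segment_commute)
    have "o' \<in> C" using o' by (simp add: C_def)
    then show "C \<noteq> {}" by blast
    show "C \<subseteq> ?O" by (fact CO)
    show "0 \<notin> C" using CO by (auto simp: proj_preimage_def)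
    show "convex C"
      unfolding convex_contains_segment
    proof (intro ballI subsetI)
      fix v w u assume vw: "v \<in> C" "w \<in> C" and "u \<in> closed_segment v w"
      then have "closed_segment v u \<subseteq> closed_segment v w"
        by (simp add: subset_closed_segment)
      then have "closed_segment v u \<subseteq> ?O" using rel[OF vw] by blast
      then show "u \<in> C" using closed vw by blast
    qed
    show "k *\<^sub>R v \<in> C" if "k > 0" "v \<in> C" for k v
    proof -
      have "closed_segment v (k *\<^sub>R v) \<subseteq> ?O"
      proof
        fix x assume "x \<in> closed_segment v (k *\<^sub>R v)"
        then obtain t where t: "0 \<le> t" "t \<le> 1" "x = (1 - t) *\<^sub>R v + t *\<^sub>R k *\<^sub>R v"
          by (auto simp: in_segment)
        then have "x = (1 - t + t * k) *\<^sub>R v" by (simp add: algebra_simps)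
        moreover have "1 - t + t * k > 0"
          using t that by (cases "t = 1") (auto intro: add_pos_nonneg)
        ultimately show "x \<in> ?O"
          using that CO proj_preimage_scaleR[of "1 - t + t * k" v D] by auto
      qed
      then show ?thesis using closed that by blast
    qed
    show "(v \<in> C \<and> w \<in> C) \<or> (- v \<in> C \<and> - w \<in> C)" if vw: "closed_segment v w \<subseteq> ?O" for v w
    proof -
      have v: "v \<in> ?O" using vw by auto
      \<comment> \<open>Reflection covers the case that \<open>- v\<close> rather than
        \<open>v\<close> lies in \<open>C\<close>: the reflected segment then carries
        \<open>- w\<close> into \<open>C\<close>.\<close>
      have "closed_segment (- v) (- w) = uminus ` closed_segment v w"
        using closed_segment_linear_image[of uminus v w] by (simp add: linear_uminus)
      then have vw': "closed_segment (- v) (- w) \<subseteq> ?O"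
        using vw by (auto simp: proj_preimage_uminus)
      have "v \<in> C \<or> - v \<in> C"
        using segment_dichotomy[OF assms(2) o' v] by (auto simp: C_def)
      then show ?thesis using closed vw vw' by blast
    qed
  qed
qed

section \<open>Separation\<close>

text \<open>A functional bounded above on a subspace vanishes on it, and a functional that is
  nonnegative on an open set and not zero is positive there.\<close>

lemma cone_subspace_separation:
  fixes C W :: "'a::euclidean_space set"
  assumes "open C" "convex C" "C \<noteq> {}" "subspace W" "W \<inter> C = {}"
  obtains g where "\<And>w. w \<in> W \<Longrightarrow> g \<bullet> w = 0" "\<And>v. v \<in> C \<Longrightarrow> g \<bullet> v > 0"
proof -
  obtain g b where g: "g \<noteq> 0" "\<forall>x\<in>W. g \<bullet> x \<le> b" "\<forall>x\<in>C. g \<bullet> x \<ge> b"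
    using separating_hyperplane_sets[of W C] assms subspace_imp_convex subspace_0 by blast
  have b: "b \<ge> 0" using g(2) subspace_0[OF assms(4)] by force
  show ?thesis
  proof
    fix w assume w: "w \<in> W"
    show "g \<bullet> w = 0"
    proof (rule ccontr)
      assume nz: "g \<bullet> w \<noteq> 0"
      \<comment> \<open>This multiple of \<open>w\<close> has value \<open>b + 1\<close>, beyond the
        bound.\<close>
      have "((b + 1) / (g \<bullet> w)) *\<^sub>R w \<in> W" using w assms(4) by (simp add: subspace_scale)
      then have "g \<bullet> (((b + 1) / (g \<bullet> w)) *\<^sub>R w) \<le> b" using g(2) by blast
      then show False using nz by simp
    qed
  next
    fix v assume "v \<in> C"
    then obtain e where e: "e > 0" "ball v e \<subseteq> C" using assms(1) open_contains_ball by blast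
    \<comment> \<open>Half the radius of the ball, in units of \<open>g\<close>: moving from
      \<open>v\<close> against \<open>g\<close> stays in \<open>C\<close> and lowers the value
      strictly.\<close>
    define d where "d = e / (2 * norm g)"
    have d: "d > 0" using e g(1) by (simp add: d_def)
    have "v - d *\<^sub>R g \<in> ball v e" using e g(1) by (simp add: d_def dist_norm)
    then have "g \<bullet> (v - d *\<^sub>R g) \<ge> b" using e g(3) by blast
    then have "g \<bullet> (v - d *\<^sub>R g) \<ge> 0" using b by linarith
    moreover have "d * (g \<bullet> g) > 0" using d g(1) by simp
    ultimately show "g \<bullet> v > 0" by (simp add: inner_diff_right)
  qed
qed

text \<open>Multiplication by \<open>cnj e\<close>, for \<open>e\<close> on a boundary ray of
  \<open>K\<close>, turns that ray onto the positive real axis. All of \<open>K\<close> makes acute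
  angles with \<open>e\<close> and lies on one side of it, hence lands in the first or the fourth
  quadrant; in the latter case a further factor \<open>\<i>\<close> corrects this.\<close>

lemma acute_cone_in_quadrant:
  fixes K :: "complex set"
  assumes "open K" "convex K" "K \<noteq> {}" "\<And>r k. r > 0 \<Longrightarrow> k \<in> K \<Longrightarrow> r *\<^sub>R k \<in> K"
    and acute: "\<And>k l. k \<in> K \<Longrightarrow> l \<in> K \<Longrightarrow> Re (k * cnj l) > 0"
  obtains c where "\<And>k. k \<in> K \<Longrightarrow> Re (c * k) > 0" "\<And>k. k \<in> K \<Longrightarrow> Im (c * k) > 0"
proof -
  have acute': "k \<bullet> l > 0" if "k \<in> K" "l \<in> K" for k l
    using acute[OF that] by (simp add: inner_complex_def)
  obtain k where k: "k \<in> K" using assms(3) by blast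
  have kk: "k \<bullet> k > 0" using acute' k by blast
  \<comment> \<open>Being orthogonal to \<open>k\<close>, the point \<open>\<i> * k\<close> is
    outside \<open>K\<close>, so the segment towards it meets the frontier, away from the
    origin.\<close>
  have ik: "\<i> * k \<notin> K" using acute'[OF k, of "\<i> * k"] by (auto simp: inner_complex_def)
  have "closed_segment k (\<i> * k) \<inter> frontier K \<noteq> {}"
    using k ik by (intro connected_Int_frontier) auto
  then obtain e where e: "e \<in> closed_segment k (\<i> * k)" "e \<in> frontier K" by blast
  have e0: "e \<noteq> 0"
  proof
    assume "e = 0"
    then obtain t where "0 = (1 - t) *\<^sub>R k + t *\<^sub>R (\<i> * k)" using e(1) by (auto simp: in_segment)
    then have "0 = (complex_of_real (1 - t) + complex_of_real t * \<i>) * k"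
      by (simp add: scaleR_conv_of_real algebra_simps)
    moreover have "complex_of_real (1 - t) + complex_of_real t * \<i> \<noteq> 0"
      by (auto simp: complex_eq_iff)
    ultimately show False using kk by auto
  qed
  have eK: "e \<notin> K" "e \<in> closure K"
    using e(2) assms(1) by (auto simp: frontier_def interior_open)
  have ge: "e \<bullet> l \<ge> 0" if "l \<in> K" for l
  proof -
    have "closure K \<subseteq> {x. l \<bullet> x \<ge> 0}"
      using acute'[OF that] by (intro closure_minimal) (auto simp: closed_halfspace_ge less_imp_le)
    then show ?thesis using eK by (auto simp: inner_commute)
  qed
  have gt: "e \<bullet> l > 0" if l: "l \<in> K" for l
  proof -
    obtain d where d: "d > 0" "ball l d \<subseteq> K" using assms(1) l open_contains_ball by blast
    define r where "r = d / (2 * norm e)"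
    have r: "r > 0" using d e0 by (simp add: r_def)
    have "l - r *\<^sub>R e \<in> ball l d" using d e0 by (simp add: r_def dist_norm)
    then have "e \<bullet> (l - r *\<^sub>R e) \<ge> 0" using d ge by blast
    moreover have "r * (e \<bullet> e) > 0" using r e0 by simp
    ultimately show ?thesis by (simp add: inner_diff_right)
  qed
  \<comment> \<open>A multiple of \<open>e\<close> in \<open>K\<close> would have a positive factor
    by acuteness, and rescaling would put \<open>e\<close> itself into \<open>K\<close>.\<close>
  have "span {e} \<inter> K = {}"
  proof -
    have "s *\<^sub>R e \<notin> K" for s
    proof
      assume s: "s *\<^sub>R e \<in> K"
      have "s * (e \<bullet> k) > 0" using acute'[OF s k] by simp
      then have "s > 0" using gt[OF k] by (simp add: zero_less_mult_iff)
      then have "inverse s *\<^sub>R (s *\<^sub>R e) \<in> K" by (intro assms(4) s) simp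
      then show False using \<open>s > 0\<close> eK(1) by (simp only: scaleR_scaleR) simp
    qed
    then show ?thesis by (auto simp: span_singleton)
  qed
  then obtain m where m: "m \<bullet> e = 0" "\<And>l. l \<in> K \<Longrightarrow> m \<bullet> l > 0"
    using cone_subspace_separation[OF assms(1-3), of "span {e}"]
    by (metis span_base singletonI subspace_span)
  \<comment> \<open>As \<open>m\<close> is orthogonal to \<open>e\<close>, it equals
    \<open>r\<close> times \<open>\<i> * e\<close>; the sign of \<open>r\<close> tells on which side
    of \<open>e\<close> the cone lies.\<close>
  define r where "r = Im (cnj e * m) / (e \<bullet> e)"
  have ee: "e \<bullet> e > 0" using e0 by simp
  have mr: "m \<bullet> l = r * Im (cnj e * l)" for l
  proof -
    have "(e \<bullet> e) * (m \<bullet> l) = (m \<bullet> e) * (e \<bullet> l) + Im (cnj e * m) * Im (cnj e * l)"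
      by (simp add: inner_complex_def algebra_simps)
    then show ?thesis using m(1) ee by (simp add: r_def field_simps)
  qed
  have re: "Re (cnj e * l) > 0" if "l \<in> K" for l
    using gt[OF that] by (simp add: inner_complex_def)
  have rk: "r * Im (cnj e * l) > 0" if "l \<in> K" for l
    using m(2)[OF that] mr by simp
  show ?thesis
  proof (cases "r > 0")
    case True
    then show ?thesis using re rk by (intro that[of "cnj e"]) (auto simp: zero_less_mult_iff)
  next
    case False
    then have "Im (cnj e * l) < 0" if "l \<in> K" for l
      using rk[OF that] by (auto simp: zero_less_mult_iff)
    then show ?thesis using re by (intro that[of "\<i> * cnj e"]) (auto simp: algebra_simps)
  qed
qed

text \<open>The plane is parametrised by \<open>k \<mapsto> Re k x + Im k y\<close>, which need not be injective.\<close>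

lemma extend_positive_functional:
  fixes C :: "'a::euclidean_space set" and c :: complex
  assumes "open C" "convex C"
    and k0: "Re k0 *\<^sub>R x + Im k0 *\<^sub>R y \<in> C"
    and pos: "\<And>k. Re k *\<^sub>R x + Im k *\<^sub>R y \<in> C \<Longrightarrow> Re (c * k) > 0"
  obtains g where "g \<bullet> x = Re c" "g \<bullet> y = - Im c" "\<And>v. v \<in> C \<Longrightarrow> g \<bullet> v > 0"
proof -
  \<comment> \<open>The functional wanted on the plane is \<open>k \<mapsto> Re (c * k)\<close>, and
    \<open>?w\<close> is the image of a parameter spanning its kernel. Separating this line from
    \<open>C\<close> gives a functional with the right kernel.\<close>
  let ?w = "Im c *\<^sub>R x + Re c *\<^sub>R y"
  have "span {?w} \<inter> C = {}"
  proof -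
    have "s *\<^sub>R ?w \<notin> C" for s
    proof
      assume "s *\<^sub>R ?w \<in> C"
      then show False
        using pos[of "Complex (s * Im c) (s * Re c)"] by (simp add: scaleR_add_right)
    qed
    then show ?thesis by (auto simp: span_singleton)
  qed
  then obtain g where g: "g \<bullet> ?w = 0" "\<And>v. v \<in> C \<Longrightarrow> g \<bullet> v > 0"
    using cone_subspace_separation[OF assms(1,2), of "span {?w}"] k0
    by (metis span_base singletonI subspace_span empty_iff)
  have ck: "Re c * Re k0 - Im c * Im k0 > 0" using pos[OF k0] by simp
  then have "c \<noteq> 0" by auto
  define q where "q = (Re c)\<^sup>2 + (Im c)\<^sup>2"
  have q: "q > 0" using \<open>c \<noteq> 0\<close> by (simp add: q_def complex_eq_iff sum_power2_gt_zero_iff)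
  \<comment> \<open>The values of \<open>g\<close> at \<open>x\<close> and \<open>y\<close> are
    proportional to the required \<open>Re c\<close> and \<open>- Im c\<close>. The factor is
    \<open>t\<close>, found by projection; evaluation at \<open>k0\<close> shows that it is
    positive, so \<open>g\<close> can be rescaled.\<close>
  define t where "t = (Re c * (g \<bullet> x) - Im c * (g \<bullet> y)) / q"
  have w: "Im c * (g \<bullet> x) + Re c * (g \<bullet> y) = 0"
    using g(1) by (simp add: inner_add_right)
  have "q * (g \<bullet> x) = q * (t * Re c)" "q * (g \<bullet> y) = q * (- (t * Im c))"
    using w q unfolding t_def by (simp_all add: field_simps, simp_all add: q_def power2_eq_square, algebra+)
  then have gx: "g \<bullet> x = t * Re c" and gy: "g \<bullet> y = - (t * Im c)"
    using q by (simp_all only: mult_cancel_left) auto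
  have "g \<bullet> (Re k0 *\<^sub>R x + Im k0 *\<^sub>R y) > 0" by (rule g(2)[OF k0])
  then have "t * (Re c * Re k0 - Im c * Im k0) > 0"
    by (simp add: inner_add_right gx gy algebra_simps)
  with ck have t: "t > 0" by (simp add: zero_less_mult_iff)
  show ?thesis
    by (rule that[of "inverse t *\<^sub>R g"]) (use t g(2) in \<open>auto simp: gx gy\<close>)
qed

section \<open>Complex functionals positive on a cone\<close>

text \<open>No conjugation is involved: \<open>f\<close> encodes a linear functional in coordinates,
  over any field.\<close>

definition bilin :: "'a::comm_semiring_0 ^ 'n::finite \<Rightarrow> 'a ^ 'n \<Rightarrow> 'a" where
  "bilin f u = (\<Sum>i\<in>UNIV. f $ i * u $ i)"

lemma bilin_add: "bilin f (u + v) = bilin f u + bilin f v"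
  by (simp add: bilin_def algebra_simps sum.distrib)

lemma bilin_smult: "bilin f (c *s u) = c * bilin f u"
  by (simp add: bilin_def sum_distrib_left mult_ac)

lemma bilin_add_left: "bilin (f + g) u = bilin f u + bilin g u"
  by (simp add: bilin_def algebra_simps sum.distrib)

lemma bilin_smult_left: "bilin (c *s f) u = c * bilin f u"
  by (simp add: bilin_def sum_distrib_left mult_ac)

lemma bilin_complexify: "bilin (complexify g) (complexify v) = complex_of_real (g \<bullet> v)"
  by (simp add: bilin_def complexify_def inner_vec_def)

lemma bilin_uminus:
  fixes f u :: "complex ^ 'n::finite"
  shows "bilin f (- u) = - bilin f u"
  by (simp add: bilin_def sum_negf)

lemma complexify_uminus: "complexify (- v) = - complexify v"
  by (simp add: complexify_def vec_eq_iff)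

lemma complexify_scaleR: "complexify (r *\<^sub>R v) = complex_of_real r *s complexify v"
  by (simp add: complexify_def vec_eq_iff)

lemma complexify_add: "complexify (v + w) = complexify v + complexify w"
  by (simp add: complexify_def vec_eq_iff)

lemma obtain_real_imaginary:
  fixes z :: "complex ^ 'n::finite"
  obtains x y where "z = complexify x + \<i> *s complexify y"
proof
  show "z = complexify (\<chi> i. Re (z $ i)) + \<i> *s complexify (\<chi> i. Im (z $ i))"
    by (simp add: vec_eq_iff complexify_def complex_eq_iff)
qed

text \<open>Cramer's rule: these are the coefficients of \<open>x\<close> and \<open>y\<close> in
  \<open>\<i> (k T l - l T k)\<close>, where \<open>T k = Re k x + Im k y\<close>. The combination
  is therefore \<open>d\<close> times \<open>x + \<i> y\<close>.\<close>

lemma complex_combination_coeffs: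
  fixes k l :: complex
  assumes "d = Re k * Im l - Im k * Re l" "d \<noteq> 0"
  shows "\<i> * (k * of_real (Re l) - l * of_real (Re k)) = of_real d"
    and "\<i> * (k * of_real (Im l) - l * of_real (Im k)) = \<i> * of_real d"
  using assms by (simp_all add: complex_eq_iff algebra_simps)

lemma exists_positive_complex_functional:
  fixes C :: "(real ^ 'n::finite) set" and z :: "complex ^ 'n"
  assumes C: "open C" "convex C" "C \<noteq> {}" "0 \<notin> C" "\<And>k v. k > 0 \<Longrightarrow> v \<in> C \<Longrightarrow> k *\<^sub>R v \<in> C"
    and z: "\<And>v w c d. v \<in> C \<Longrightarrow> w \<in> C \<Longrightarrow> Re (c * cnj d) \<ge> 0 \<Longrightarrow>
              z \<noteq> c *s complexify v + d *s complexify w"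
  obtains f where "bilin f z = 0"
    "\<And>v w. v \<in> C \<Longrightarrow> w \<in> C \<Longrightarrow> Re (bilin f (complexify v) * cnj (bilin f (complexify w))) > 0"
proof -
  obtain x y where zxy: "z = complexify x + \<i> *s complexify y" by (rule obtain_real_imaginary)
  define T where "T k = Re k *\<^sub>R x + Im k *\<^sub>R y" for k
  define K where "K = {k. T k \<in> C}"
  have linT: "linear T"
    by (rule linearI) (auto simp: T_def algebra_simps)
  then have T_add: "T (k + l) = T k + T l" and T_scale: "T (r *\<^sub>R k) = r *\<^sub>R T k" for k l r
    by (auto simp: linear_add linear_cmul)
  have K_vimage: "K = T -` C" by (auto simp: K_def)
  have cone: "r *\<^sub>R k \<in> K" if "r > 0" "k \<in> K" for r k
    using C(5) that by (simp add: K_def T_scale)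
  have K: "open K" "convex K"
    unfolding K_vimage
    using C(1,2) linT by (auto intro!: open_vimage convex_linear_vimage linear_continuous_on simp: linear_conv_bounded_linear)
  \<comment> \<open>A pair at a nonacute angle would express \<open>z\<close> as a point of an
    elliptic segment, or put the origin into \<open>C\<close>.\<close>
  have acute: "Re (k * cnj l) > 0" if k: "k \<in> K" and l: "l \<in> K" for k l
  proof (rule ccontr)
    assume neg: "\<not> Re (k * cnj l) > 0"
    define d where "d = Re k * Im l - Im k * Re l"
    show False
    proof (cases "d = 0")
      case True
      \<comment> \<open>With zero determinant \<open>k\<close> and \<open>l\<close> are real
        multiples of each other pointing in opposite directions, so convexity of \<open>K\<close>
        yields 0.\<close>
      have k0: "k \<noteq> 0" using k C(4) by (auto simp: K_def T_def)
      define r where "r = - Re (k * cnj l)"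
      have r: "r \<ge> 0" using neg by (simp add: r_def)
      have kk: "k \<bullet> k > 0" using k0 by simp
      have e: "(k \<bullet> k) *\<^sub>R l + r *\<^sub>R k = 0"
        using True unfolding complex_eq_iff r_def d_def inner_complex_def
        by (simp add: algebra_simps)
      have "r \<noteq> 0"
        using e kk l C(4) by (auto simp: K_def T_def)
      then have "r *\<^sub>R k \<in> K" "(k \<bullet> k) *\<^sub>R l \<in> K" using cone k l kk r by auto
      then have "(1/2) *\<^sub>R ((k \<bullet> k) *\<^sub>R l) + (1/2) *\<^sub>R (r *\<^sub>R k) \<in> K"
        by (intro convexD[OF K(2)]) auto
      then have "(1/2) *\<^sub>R ((k \<bullet> k) *\<^sub>R l + r *\<^sub>R k) \<in> K" by (simp add: scaleR_add_right)
      then have "0 \<in> K" using e by simp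
      then show False using C(4) by (simp add: K_def T_def)
    next
      case False
      define t where "t = \<i> / of_real d"
      have "z = (- (t * l)) *s complexify (T k) + (t * k) *s complexify (T l)"
      proof -
        have "(- (t * l)) *s complexify (T k) + (t * k) *s complexify (T l) =
          (t * (k * of_real (Re l) - l * of_real (Re k))) *s complexify x +
          (t * (k * of_real (Im l) - l * of_real (Im k))) *s complexify y"
          by (simp add: T_def complexify_add complexify_scaleR vec_eq_iff algebra_simps)
        also have "\<dots> = z"
          unfolding t_def times_divide_eq_left complex_combination_coeffs[OF d_def False]
          using False zxy by simp
        finally show ?thesis ..
      qed
      moreover have "Re (- (t * l) * cnj (t * k)) \<ge> 0"
      proof -
        \<comment> \<open>The product of the coefficients is a negative multiple of
          \<open>l * cnj k\<close>, so a nonacute angle is just what the hypothesis on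
          \<open>z\<close> forbids.\<close>
        have "- (t * l) * cnj (t * k) = of_real (- 1 / d\<^sup>2) * (l * cnj k)"
          using False by (simp add: t_def field_simps power2_eq_square)
        moreover have "Re (l * cnj k) \<le> 0" using neg by (simp add: algebra_simps)
        ultimately show ?thesis by (simp add: divide_nonpos_nonneg)
      qed
      ultimately show False using z k l unfolding K_def by blast
    qed
  qed
  show ?thesis
  proof (cases "K = {}")
    case True
    have "span {x, y} \<inter> C = {}"
    proof -
      have "a *\<^sub>R x + b *\<^sub>R y \<notin> C" for a b
        using True by (auto simp: K_def T_def dest!: spec[of _ "Complex a b"])
      then show ?thesis
        by (auto simp: span_insert span_singleton diff_eq_eq add.commute)
    qed
    then obtain g where g: "\<And>w. w \<in> span {x, y} \<Longrightarrow> g \<bullet> w = 0" "\<And>v. v \<in> C \<Longrightarrow> g \<bullet> v > 0"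
      using cone_subspace_separation[OF C(1-3), of "span {x, y}"] by (metis subspace_span)
    show ?thesis
    proof (rule that[of "complexify g"])
      have "g \<bullet> x = 0" "g \<bullet> y = 0" by (auto intro!: g(1) span_base)
      then show "bilin (complexify g) z = 0"
        by (simp add: zxy bilin_add bilin_smult bilin_complexify)
    qed (use g(2) in \<open>simp add: bilin_complexify\<close>)
  next
    case False
    obtain c where c: "\<And>k. k \<in> K \<Longrightarrow> Re (c * k) > 0" "\<And>k. k \<in> K \<Longrightarrow> Im (c * k) > 0"
      using acute_cone_in_quadrant[OF K False cone acute] by blast
    from False obtain k0 where k0: "Re k0 *\<^sub>R x + Im k0 *\<^sub>R y \<in> C" by (auto simp: K_def T_def)
    obtain g where g: "g \<bullet> x = Re c" "g \<bullet> y = - Im c" "\<And>v. v \<in> C \<Longrightarrow> g \<bullet> v > 0"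
      using extend_positive_functional[OF C(1,2) k0, of c] c(1) by (auto simp: K_def T_def)
    \<comment> \<open>\<open>Re (- \<i> * c * k)\<close> is \<open>Im (c * k)\<close>, so
      \<open>h\<close> extends the imaginary part. Together \<open>g + \<i> h\<close> sends the
      point with parameter \<open>k\<close> to \<open>c * k\<close>, hence \<open>z\<close> to
      \<open>c + \<i> * (c * \<i>) = 0\<close>.\<close>
    obtain h where h: "h \<bullet> x = Re (- \<i> * c)" "h \<bullet> y = - Im (- \<i> * c)" "\<And>v. v \<in> C \<Longrightarrow> h \<bullet> v > 0"
      using extend_positive_functional[OF C(1,2) k0, of "- \<i> * c"] c(2)
      by (auto simp: K_def T_def)
    let ?f = "complexify g + \<i> *s complexify h"
    have f: "bilin ?f (complexify v) = Complex (g \<bullet> v) (h \<bullet> v)" for v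
      by (simp add: bilin_add_left bilin_smult_left bilin_complexify complex_eq_iff)
    show ?thesis
    proof (rule that[of ?f])
      show "bilin ?f z = 0"
        using g h by (simp add: zxy bilin_add bilin_smult f complex_eq_iff)
      show "Re (bilin ?f (complexify v) * cnj (bilin ?f (complexify w))) > 0" if "v \<in> C" "w \<in> C" for v w
        using that g(3) h(3) by (simp add: f add_pos_pos)
    qed
  qed
qed

section \<open>Hyperplanes\<close>

text \<open>Serves the empty \<open>D\<close>, where any hyperplane through the given point will do.
  Two coordinates suffice to write one down.\<close>

lemma exists_annihilating_functional:
  fixes z :: "complex ^ 'n::finite"
  assumes "CARD('n) \<ge> 2"
  obtains f where "f \<noteq> 0" "bilin f z = 0"
proof -
  obtain i j :: 'n where ij: "i \<noteq> j"
    using assms by (metis UNIV_I card_2_iff' card_le_Suc0_iff_eq finite not_less_eq_eq numeral_2_eq_2)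
  show ?thesis
  proof (cases "z $ i = 0 \<and> z $ j = 0")
    case True
    show ?thesis
    proof (rule that[of "axis i 1"])
      show "bilin (axis i 1) z = 0"
        using True by (simp add: bilin_def axis_def if_distrib[of "\<lambda>a. a * _"] cong: if_cong)
    qed (simp add: axis_eq_0_iff)
  next
    case False
    let ?f = "axis i (z $ j) + axis j (- (z $ i))"
    have "bilin ?f z = 0"
      by (simp add: bilin_add_left) (simp add: bilin_def axis_def if_distrib[of "\<lambda>a. a * _"] cong: if_cong)
    moreover have "?f $ i = z $ j" "?f $ j = - (z $ i)" using ij by (auto simp: axis_def)
    then have "?f \<noteq> 0" using False by (metis neg_equal_0_iff_equal zero_index)
    ultimately show ?thesis using that by blast
  qed
qed

text \<open>A vector \<open>e\<close> of value 1 spans a complement of the kernel, since subtracting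
  \<open>bilin f u *s e\<close> from \<open>u\<close> lands in the kernel.\<close>

lemma proj_hyperplane_kernel:
  fixes f :: "'a::field ^ 'n::finite"
  assumes "f \<noteq> 0"
  shows "proj_hyperplane (proj_image {u. bilin f u = 0})"
proof -
  let ?S = "{u. bilin f u = 0}"
  have S: "vec.subspace ?S"
    by (rule vec.subspaceI) (auto simp: bilin_add bilin_smult, simp add: bilin_def)
  obtain i where i: "f $ i \<noteq> 0" using assms by (auto simp: vec_eq_iff)
  define e where "e = axis i (inverse (f $ i))"
  have e: "bilin f e = 1"
    using i by (simp add: bilin_def e_def axis_def if_distrib[of "\<lambda>a. _ * a"] cong: if_cong)
  have "u \<in> vec.span (insert e ?S)" for u
  proof -
    have "bilin f (u - bilin f u *s e) = 0"
      using bilin_add[of f "u - bilin f u *s e" "bilin f u *s e"] by (simp add: bilin_smult e)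
    then show ?thesis
      by (auto simp: vec.span_insert intro!: exI[of _ "bilin f u"] vec.span_base)
  qed
  then have span: "vec.span (insert e ?S) = UNIV" by auto
  have "vec.dim (insert e ?S) = vec.dim (vec.span (insert e ?S))"
    by (simp only: vec.dim_span)
  also have "\<dots> = CARD('n)" by (simp only: span vec_dim_card)
  finally have "vec.dim (insert e ?S) = CARD('n)" .
  moreover have "e \<notin> vec.span ?S"
    using e S by (simp add: vec.span_eq_iff[THEN iffD2])
  ultimately have "vec.dim ?S + 1 = CARD('n)"
    by (simp add: vec.dim_insert)
  with S show ?thesis unfolding proj_hyperplane_def by blast
qed

lemma proj_image_kernel_iff:
  assumes "u \<noteq> 0"
  shows "abs_proj u \<in> proj_image {u. bilin f u = 0} \<longleftrightarrow> bilin f u = 0"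
proof
  assume "abs_proj u \<in> proj_image {u. bilin f u = 0}"
  then obtain v where v: "v \<noteq> 0" "bilin f v = 0" "abs_proj u = abs_proj v"
    unfolding proj_image_def by blast
  then obtain c where "u = c *s v" using abs_proj_eq_iff[OF v(1) assms] by metis
  then show "bilin f u = 0" using v(2) by (simp add: bilin_smult)
qed (use assms in \<open>auto simp: proj_image_def\<close>)

text \<open>Multiplying \<open>c * a = - (d * b)\<close> by \<open>cnj d * cnj a\<close> leaves only
  squared moduli beside the two real parts, which would then have opposite signs. This is why a
  functional with acute values has no zero on an elliptic segment.\<close>

lemma acute_combination_eq_0:
  fixes a b c d :: complex
  assumes "c * a + d * b = 0" "Re (a * cnj b) > 0" "Re (c * cnj d) \<ge> 0"
  shows "c = 0 \<and> d = 0"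
proof -
  have "c * a = - (d * b)" using assms(1) by (simp add: eq_neg_iff_add_eq_0)
  then have "(c * a) * (cnj d * cnj a) = - (d * b) * (cnj d * cnj a)" by simp
  then have "c * cnj d * (a * cnj a) = - (d * cnj d * (b * cnj a))"
    by (simp add: mult_ac)
  then have "Re (c * cnj d * (a * cnj a)) = Re (- (d * cnj d * (b * cnj a)))" by simp
  then have "Re (c * cnj d) * (cmod a)\<^sup>2 = - ((cmod d)\<^sup>2 * Re (a * cnj b))"
    by (simp add: complex_mult_cnj cmod_power2 algebra_simps)
  then have "(cmod d)\<^sup>2 * Re (a * cnj b) \<le> 0"
    using assms(3) by (metis neg_le_0_iff_le add.inverse_inverse mult_nonneg_nonneg zero_le_power2 neg_0_le_iff_le)
  then have "d = 0" using assms(2) by (auto simp: mult_le_0_iff)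
  moreover have "a \<noteq> 0" using assms(2) by auto
  ultimately show ?thesis using assms(1) by auto
qed

section \<open>The hyperplane through a point outside the tube\<close>

theorem corollary3p3:
  fixes D :: "(real, 'n::finite) proj set"
  assumes "CARD('n) \<ge> 2"
    and "open D"
    and "proj_convex D"
  shows "linearly_convex (elliptic_tube D)"
  unfolding linearly_convex_def
proof (intro allI impI)
  fix p assume p: "p \<notin> elliptic_tube D"
  obtain z where z: "z \<noteq> 0" "p = abs_proj z" by (rule abs_proj_surj)
  show "\<exists>H. proj_hyperplane H \<and> p \<in> H \<and> H \<inter> elliptic_tube D = {}"
  proof (cases "D = {}")
    case True
    \<comment> \<open>Coefficients 1 and 0 show that a segment contains its endpoint, so an empty
      \<open>D\<close> has no segments and an empty tube.\<close>
    have "v0 = 0" if "proj_segment v0 v1 \<subseteq> D" for v0 v1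
    proof -
      have "1 *s v0 + 0 *s v1 \<in> {c0 *s v0 + c1 *s v1 | c0 c1. c0 * c1 \<ge> 0}"
        by (intro CollectI exI[of _ 1] exI[of _ 0]) auto
      moreover have "{c0 *s v0 + c1 *s v1 | c0 c1. c0 * c1 \<ge> 0} - {0} \<subseteq> {}"
        using that True unfolding proj_segment_def proj_image_subset_iff by (simp add: proj_preimage_def)
      ultimately have "1 *s v0 + 0 *s v1 \<in> {0}" by blast
      then show ?thesis by simp
    qed
    then have "elliptic_tube D = {}" by (auto simp: elliptic_tube_def)
    moreover obtain f where "f \<noteq> 0" "bilin f z = 0"
      using exists_annihilating_functional[OF assms(1)] .
    ultimately show ?thesis
      using proj_hyperplane_kernel[of f] proj_image_kernel_iff[OF z(1), of f] z(2) by auto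
  next
    case False
    obtain C where C: "open C" "convex C" "C \<noteq> {}" "0 \<notin> C" "\<And>k v. k > 0 \<Longrightarrow> v \<in> C \<Longrightarrow> k *\<^sub>R v \<in> C"
      "C \<subseteq> proj_preimage D"
      "\<And>v w. closed_segment v w \<subseteq> proj_preimage D \<Longrightarrow> (v \<in> C \<and> w \<in> C) \<or> (- v \<in> C \<and> - w \<in> C)"
      using obtain_convex_cone[OF assms(2,3) False] by blast
    have seg: "proj_segment v w \<subseteq> D" if "v \<in> C" "w \<in> C" for v w
      unfolding proj_segment_def proj_image_subset_iff
    proof
      fix u assume "u \<in> {c0 *s v + c1 *s w | c0 c1. c0 * c1 \<ge> 0} - {0}"
      then obtain a b where u: "u = a *\<^sub>R v + b *\<^sub>R w" "a * b \<ge> 0" "u \<noteq> 0"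
        by (auto simp: scalar_mult_eq_scaleR)
      \<comment> \<open>Up to a positive factor this is a convex combination; nonpositive
        coefficients are reduced to it by passing to \<open>- u\<close>.\<close>
      have pos: "a *\<^sub>R v + b *\<^sub>R w \<in> C" if ab: "a \<ge> 0" "b \<ge> 0" "a \<noteq> 0 \<or> b \<noteq> 0" for a b
      proof -
        have s: "a + b > 0" using ab by auto
        have "(a / (a + b)) *\<^sub>R v + (b / (a + b)) *\<^sub>R w \<in> C"
          using ab s \<open>v \<in> C\<close> \<open>w \<in> C\<close> by (intro convexD[OF C(2)]) (auto simp flip: add_divide_distrib)
        then have "(a + b) *\<^sub>R ((a / (a + b)) *\<^sub>R v + (b / (a + b)) *\<^sub>R w) \<in> C"
          using C(5) s by blast
        then show ?thesis using s by (simp add: scaleR_add_right)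
      qed
      have ab: "a \<noteq> 0 \<or> b \<noteq> 0" using u(1,3) by auto
      consider "a \<ge> 0" "b \<ge> 0" | "a \<le> 0" "b \<le> 0" using u(2) by (auto simp: zero_le_mult_iff)
      then have "u \<in> C \<or> - u \<in> C"
      proof cases
        case 1
        then show ?thesis using pos[of a b] u ab by auto
      next
        case 2
        then show ?thesis using pos[of "-a" "-b"] u ab by auto
      qed
      then show "u \<in> proj_preimage D" using C(6) proj_preimage_uminus[of u D] by blast
    qed
    \<comment> \<open>Segments between vectors of \<open>C\<close> stay in \<open>D\<close>, so
      their elliptic segments belong to the tube, which \<open>p\<close> avoids.\<close>
    have "z \<noteq> c *s complexify v + d *s complexify w"
      if "v \<in> C" "w \<in> C" "Re (c * cnj d) \<ge> 0" for v w c d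
    proof
      assume "z = c *s complexify v + d *s complexify w"
      then have "p \<in> elliptic_segment v w"
        using z that(3) by (auto simp: elliptic_segment_def proj_image_def)
      then have "p \<in> elliptic_tube D"
        using seg[OF that(1,2)] that(1,2) C(4) unfolding elliptic_tube_def by blast
      with p show False ..
    qed
    then obtain f where f: "bilin f z = 0"
      "\<And>v w. v \<in> C \<Longrightarrow> w \<in> C \<Longrightarrow> Re (bilin f (complexify v) * cnj (bilin f (complexify w))) > 0"
      using exists_positive_complex_functional[OF C(1-5)] by blast
    let ?H = "proj_image {u. bilin f u = 0}"
    have fO: "bilin f (complexify v) \<noteq> 0" if "v \<in> proj_preimage D" for v
    proof -
      have "v \<in> C \<or> - v \<in> C" using C(7)[of v v] that by auto
      then show ?thesis
        using f(2)[of v v] f(2)[of "-v" "-v"] by (auto simp: complexify_uminus bilin_uminus)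
    qed
    obtain v where "v \<in> C" using C(3) by blast
    then have "bilin f (complexify v) \<noteq> 0" using C(6) fO by blast
    then have "f \<noteq> 0" by (auto simp: bilin_def)
    moreover have "p \<in> ?H" using proj_image_kernel_iff[OF z(1)] z(2) f(1) by blast
    moreover have "?H \<inter> elliptic_tube D = {}"
    proof (rule ccontr)
      assume "?H \<inter> elliptic_tube D \<noteq> {}"
      then obtain q v w where q: "q \<in> ?H" "q \<in> elliptic_segment v w"
        and v: "v \<noteq> 0" and w: "w \<noteq> 0" and vw: "proj_segment v w \<subseteq> D"
        unfolding elliptic_tube_def by blast
      from q(2) obtain c d where u: "c *s complexify v + d *s complexify w \<noteq> 0"
        "q = abs_proj (c *s complexify v + d *s complexify w)" and cd: "Re (c * cnj d) \<ge> 0"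
        by (auto simp: elliptic_segment_def proj_image_def)
      have fu: "c * bilin f (complexify v) + d * bilin f (complexify w) = 0"
        using q(1) proj_image_kernel_iff[OF u(1), of f] u(2) by (simp add: bilin_add bilin_smult)
      have comb: "a *\<^sub>R v + b *\<^sub>R w \<in> proj_preimage D" if "a * b \<ge> 0" "a *\<^sub>R v + b *\<^sub>R w \<noteq> 0" for a b
        using vw that unfolding proj_segment_def proj_image_subset_iff scalar_mult_eq_scaleR
        by blast
      show False
      proof (cases "0 \<in> closed_segment v w")
        case True
        \<comment> \<open>The representatives of a degenerate segment may be opposite vectors.\<close>
        then obtain t where t: "0 \<le> t" "t \<le> 1" "(1 - t) *\<^sub>R v + t *\<^sub>R w = 0"
          by (auto simp: in_segment)
        have "t \<noteq> 0" using t v by auto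
        have "t *\<^sub>R w = (t - 1) *\<^sub>R v"
          using t(3) by (simp add: algebra_simps eq_neg_iff_add_eq_0)
        then have "inverse t *\<^sub>R t *\<^sub>R w = inverse t *\<^sub>R (t - 1) *\<^sub>R v" by simp
        then obtain r where r: "w = r *\<^sub>R v" using \<open>t \<noteq> 0\<close> by auto
        \<comment> \<open>The vector in question is a multiple of \<open>complexify v\<close>, where
          \<open>f\<close> does not vanish, so its coefficient would have to be 0.\<close>
        have "(c + d * of_real r) * bilin f (complexify v) = 0"
          using fu by (simp add: r complexify_scaleR bilin_smult algebra_simps)
        moreover have "v \<in> proj_preimage D" using comb[of 1 0] v by simp
        ultimately have "c + d * of_real r = 0" using fO by auto
        moreover have "c *s complexify v + d *s complexify w = (c + d * of_real r) *s complexify v"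
          by (simp add: r complexify_scaleR vec_eq_iff algebra_simps)
        ultimately show False using u(1) by simp
      next
        case False
        have "closed_segment v w \<subseteq> proj_preimage D"
        proof
          fix x assume x: "x \<in> closed_segment v w"
          then obtain t where t: "0 \<le> t" "t \<le> 1" "x = (1 - t) *\<^sub>R v + t *\<^sub>R w"
            by (auto simp: in_segment)
          have "x \<noteq> 0" using x False by blast
          then show "x \<in> proj_preimage D" using comb[of "1 - t" t] t by simp
        qed
        \<comment> \<open>Both vectors lie in \<open>C\<close> or both in \<open>- C\<close>; a
          common change of sign does not affect the product.\<close>
        then have "Re (bilin f (complexify v) * cnj (bilin f (complexify w))) > 0"
          using C(7)[of v w] f(2)[of v w] f(2)[of "-v" "-w"]
          by (auto simp: complexify_uminus bilin_uminus)
        then have "c = 0 \<and> d = 0" using acute_combination_eq_0[OF fu _ cd] by blast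
        then show False using u(1) by simp
      qed
    qed
    ultimately show ?thesis using proj_hyperplane_kernel by blast
  qed
qed

end
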